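(* A rational function $R$ with complex coefficients satisfies $\mathfrak{F}(R) = R$ if and only if it is a (finite, complex) linear combination of $\frac{1}{x}$ and the functions $f_{r,n}(x)$ for $r$ an odd positive integer and $0 \le n \le r-1$.
   Context: For a rational function $R$ with complex coefficients and Laurent expansion $R(x) = \sum_{k \gg -\infty} a_k x^k$ at $x=0$ (the coefficients vanish for all sufficiently negative $k$), define $$\mathfrak{F}(R(x)) = \sum_{k \gg -\infty} a_{2k+1} x^k = \frac{R(\sqrt{x}) - R(-\sqrt{x})}{2\sqrt{x}},$$ which is again a rational function. For integers $r \geq 1$ odd and $0 \le n \le r-1$, the $2$-cyclotomic coset of $n$ mod $r$ is the finite set $C_{r,n} = \{ 2^s n \bmod r : s \in \mathbb{Z} \}$ ($2$ is invertible modulo $r$). For each odd $r$ fix a primitive $r$-th root of unity $\lambda = \lambda_r$ and define $$f_{r,n}(x) = \sum_{m \in C_{r,n}} \frac{\lambda^m}{1 - \lambda^m x}.$$ *)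

theory Defs
  imports
    Complex_Main
    "HOL-Computational_Algebra.Computational_Algebra"
    "HOL-Number_Theory.Number_Theory"
begin

type_synonym ratfun = "complex poly fract"

abbreviation fls_of_poly :: "complex poly \<Rightarrow> complex fls" where
  "fls_of_poly p \<equiv> fps_to_fls (fps_of_poly p)"

lemma fls_of_poly_eq_iff: "fls_of_poly p = fls_of_poly q \<longleftrightarrow> p = q"
  by (simp add: fps_of_poly_eq_iff)

lemma fls_of_poly_eq_0_iff: "fls_of_poly p = 0 \<longleftrightarrow> p = 0"
  using fls_of_poly_eq_iff[of p 0] by simp

lemma fls_of_poly_mult: "fls_of_poly (p * q) = fls_of_poly p * fls_of_poly q"
  by (simp add: fps_of_poly_mult fls_times_fps_to_fls)

text \<open>
  The Laurent expansion at the origin of a rational function; it does not depend on the chosen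
  representation as a fraction, see \<open>laurent_Fract\<close>.
\<close>

definition laurent :: "ratfun \<Rightarrow> complex fls" where
  "laurent R = (THE L. \<exists>p q. q \<noteq> 0 \<and> R = Fract p q \<and> L = fls_of_poly p / fls_of_poly q)"

lemma laurent_Fract:
  assumes "q \<noteq> 0"
  shows "laurent (Fract p q) = fls_of_poly p / fls_of_poly q"
  unfolding laurent_def
proof (rule the_equality)
  fix L assume "\<exists>p' q'. q' \<noteq> 0 \<and> Fract p q = Fract p' q' \<and> L = fls_of_poly p' / fls_of_poly q'"
  then obtain p' q' where *: "q' \<noteq> 0" "Fract p q = Fract p' q'" "L = fls_of_poly p' / fls_of_poly q'"
    by blast
  hence "p * q' = p' * q"
    using assms by (simp add: eq_fract)
  hence "fls_of_poly p * fls_of_poly q' = fls_of_poly p' * fls_of_poly q"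
    by (simp only: flip: fls_of_poly_mult)
  thus "L = fls_of_poly p / fls_of_poly q"
    using * assms by (simp add: frac_eq_eq fls_of_poly_eq_0_iff del: fps_to_fls_eq_0_iff)
qed (use assms in blast)

lemma laurent_eq_iff: "laurent R = laurent S \<longleftrightarrow> R = S"
proof
  assume eq: "laurent R = laurent S"
  obtain p q where R: "R = Fract p q" "q \<noteq> 0" by (cases R)
  obtain p' q' where S: "S = Fract p' q'" "q' \<noteq> 0" by (cases S)
  have "fls_of_poly p * fls_of_poly q' = fls_of_poly p' * fls_of_poly q"
    using eq R(2) S(2) unfolding R(1) S(1)
    by (simp add: laurent_Fract frac_eq_eq fls_of_poly_eq_0_iff del: fps_to_fls_eq_0_iff)
  hence "p * q' = p' * q"
    by (simp only: fls_of_poly_eq_iff flip: fls_of_poly_mult)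
  thus "R = S" using R S by (simp add: eq_fract)
qed simp

definition odd_section :: "complex fls \<Rightarrow> complex fls" where
  "odd_section L = Abs_fls (\<lambda>k. fls_nth L (2 * k + 1))"

lemma odd_section_nth: "fls_nth (odd_section L) k = fls_nth L (2 * k + 1)"
proof -
  have "\<forall>k < min 0 (fls_subdegree L). fls_nth L (2 * k + 1) = 0"
    by (auto intro!: fls_eq0_below_subdegree)
  thus ?thesis
    unfolding odd_section_def by (rule nth_Abs_fls_lower_bound)
qed

text \<open>
  The existence and uniqueness of this rational function are the content of
  \<open>laurent_frakF\<close> and \<open>frakF_unique\<close> below.
\<close>

definition frakF :: "ratfun \<Rightarrow> ratfun" where
  "frakF R = (THE S. laurent S = odd_section (laurent R))"

lemma poly_even_odd_split:
  fixes p :: "complex poly"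
  shows "\<exists>a b. p = pcompose a [:0, 0, 1:] + [:0, 1:] * pcompose b [:0, 0, 1:]"
proof (induction p)
  case 0
  show ?case by (intro exI[of _ 0]) simp
next
  case (pCons c p)
  then obtain a b where ab: "p = pcompose a [:0, 0, 1:] + [:0, 1:] * pcompose b [:0, 0, 1:]"
    by blast
  show ?case
    by (intro exI[of _ "pCons c b"] exI[of _ a], subst ab) (simp add: pcompose_pCons algebra_simps)
qed

lemma odd_section_add: "odd_section (L + M) = odd_section L + odd_section M"
  by (intro fls_eqI) (simp add: odd_section_nth)

lemma odd_section_const_mult: "odd_section (fls_const c * L) = fls_const c * odd_section L"
  by (intro fls_eqI) (simp add: odd_section_nth)

lemma odd_section_mult_X2: "odd_section (fls_X * (fls_X * L)) = fls_X * odd_section L"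
  by (intro fls_eqI) (simp add: odd_section_nth fls_X_times_conv_shift algebra_simps)

lemma fls_of_poly_pCons: "fls_of_poly (pCons c p) = fls_const c + fls_X * fls_of_poly p"
  by (simp add: fps_of_poly_pCons fls_times_fps_to_fls mult.commute)

lemma fls_of_poly_add: "fls_of_poly (p + q) = fls_of_poly p + fls_of_poly q"
  by (simp add: fps_of_poly_add)

lemma odd_section_mult_pcompose:
  "odd_section (L * fls_of_poly (pcompose q [:0, 0, 1:])) = odd_section L * fls_of_poly q"
proof (induction q)
  case 0
  show ?case by (intro fls_eqI) (simp add: odd_section_nth)
next
  case (pCons c q)
  have "L * fls_of_poly (pcompose (pCons c q) [:0, 0, 1:]) =
        fls_const c * L + fls_X * (fls_X * (L * fls_of_poly (pcompose q [:0, 0, 1:])))"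
    by (simp add: pcompose_pCons fls_of_poly_add fls_of_poly_pCons algebra_simps
        del: fps_to_fls_plus)
  thus ?case
    by (simp only: odd_section_add odd_section_const_mult odd_section_mult_X2 pCons.IH
        fls_of_poly_pCons) (simp add: algebra_simps)
qed

lemma ex_laurent_odd_section: "\<exists>S. laurent S = odd_section (laurent R)"
proof -
  obtain p q where R: "R = Fract p q" "q \<noteq> 0" by (cases R)
  let ?s = "\<lambda>p. pcompose p [:0, 0, 1 :: complex:]"
  obtain a b where p: "p = ?s a + [:0, 1:] * ?s b" using poly_even_odd_split by blast
  obtain c d where q: "q = ?s c + [:0, 1:] * ?s d" using poly_even_odd_split by blast
  define q' where "q' = ?s c - [:0, 1:] * ?s d"
  define A where "A = a * c - [:0, 1:] * (b * d)"
  define B where "B = b * c - a * d"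
  define Q where "Q = c * c - [:0, 1:] * (d * d)"
  have X2: "?s [:0, 1:] = [:0, 1:] * [:0, 1:]"
    by (simp add: pcompose_pCons)
  have q'_q: "q' = pcompose q [:0, -1:]"
    unfolding q'_def q by (simp add: pcompose_add pcompose_mult pcompose_pCons flip: pcompose_assoc)
  have "q' \<noteq> 0"
    using R(2) unfolding q'_q by (simp add: pcompose_eq_0_iff)
  have Q: "?s Q = q * q'"
    unfolding q q'_def Q_def pcompose_diff pcompose_mult X2
    by (simp only: algebra_simps)
  have AB: "?s A + [:0, 1:] * ?s B = p * q'"
    unfolding p q'_def A_def B_def pcompose_diff pcompose_mult X2
    by (simp only: algebra_simps)
  have "Q \<noteq> 0"
    using Q \<open>q' \<noteq> 0\<close> R(2) by auto
  have "laurent R * fls_of_poly (?s Q) = 1 * fls_of_poly (?s A) + fls_X * fls_of_poly (?s B)"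
  proof -
    have "laurent R * fls_of_poly (?s Q) = fls_of_poly (p * q')"
      unfolding Q R(1) laurent_Fract[OF R(2)] fls_of_poly_mult
      using R(2) by (simp add: fls_of_poly_eq_0_iff del: fps_to_fls_eq_0_iff)
    also have "\<dots> = 1 * fls_of_poly (?s A) + fls_X * fls_of_poly (?s B)"
      unfolding AB[symmetric] fls_of_poly_add fls_of_poly_mult by simp
    finally show ?thesis .
  qed
  hence "odd_section (laurent R) * fls_of_poly Q =
         odd_section 1 * fls_of_poly A + odd_section fls_X * fls_of_poly B"
    by (metis odd_section_add odd_section_mult_pcompose)
  also have "odd_section 1 = 0"
    by (intro fls_eqI) (simp add: odd_section_nth, presburger)
  also have "odd_section fls_X = 1"
    by (intro fls_eqI) (simp add: odd_section_nth)
  finally have "laurent (Fract B Q) = odd_section (laurent R)"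
    using \<open>Q \<noteq> 0\<close>
    by (simp add: laurent_Fract fls_of_poly_eq_0_iff field_simps del: fps_to_fls_eq_0_iff)
  thus ?thesis by blast
qed

lemma laurent_frakF: "laurent (frakF R) = odd_section (laurent R)"
proof -
  have "\<exists>!S. laurent S = odd_section (laurent R)"
    using ex_laurent_odd_section laurent_eq_iff by metis
  thus ?thesis unfolding frakF_def by (rule theI')
qed

lemma frakF_unique: "laurent S = odd_section (laurent R) \<Longrightarrow> frakF R = S"
  by (simp add: laurent_frakF flip: laurent_eq_iff)

text \<open>The integer powers of 2 modulo \<open>r\<close>, for odd \<open>r\<close>.\<close>

definition two_powi_mod :: "nat \<Rightarrow> int \<Rightarrow> int" where
  "two_powi_mod r s =
     (if 0 \<le> s then 2 ^ nat s else modular_inverse (int r) 2 ^ nat (- s)) mod int r"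

definition cyc_coset :: "nat \<Rightarrow> nat \<Rightarrow> nat set" where
  "cyc_coset r n = {nat ((two_powi_mod r s * int n) mod int r) |s. True}"

lemma finite_cyc_coset:
  assumes "r > 0"
  shows "finite (cyc_coset r n)"
proof (rule finite_subset)
  show "cyc_coset r n \<subseteq> {..<r}"
    using assms by (auto simp: cyc_coset_def nat_less_iff)
qed simp

definition primitive_root_of_unity :: "nat \<Rightarrow> complex \<Rightarrow> bool" where
  "primitive_root_of_unity r z \<longleftrightarrow> r > 0 \<and> z ^ r = 1 \<and> (\<forall>k. 0 < k \<and> k < r \<longrightarrow> z ^ k \<noteq> 1)"

definition cyc_fun :: "(nat \<Rightarrow> complex) \<Rightarrow> nat \<Rightarrow> nat \<Rightarrow> ratfun" where
  "cyc_fun lam r n = (\<Sum>m\<in>cyc_coset r n. Fract [:lam r ^ m:] [:1, - (lam r ^ m):])"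

definition ratfun_scale :: "complex \<Rightarrow> ratfun \<Rightarrow> ratfun" where
  "ratfun_scale c R = Fract [:c:] 1 * R"

interpretation ratfun: vector_space ratfun_scale
proof
  fix a b :: complex and x y :: ratfun
  have add: "Fract [:a + b:] 1 = Fract [:a:] 1 + (Fract [:b:] 1 :: ratfun)" by simp
  show "ratfun_scale (a + b) x = ratfun_scale a x + ratfun_scale b x"
    unfolding ratfun_scale_def add by (rule distrib_right)
  show "ratfun_scale a (x + y) = ratfun_scale a x + ratfun_scale a y"
    unfolding ratfun_scale_def by (rule distrib_left)
  have mult: "Fract [:a * b:] 1 = Fract [:a:] 1 * (Fract [:b:] 1 :: ratfun)"
    by (simp add: mult.commute)
  show "ratfun_scale a (ratfun_scale b x) = ratfun_scale (a * b) x"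
    unfolding ratfun_scale_def mult by (simp only: mult.assoc)
  show "ratfun_scale 1 x = x"
    by (simp add: ratfun_scale_def flip: One_fract_def one_pCons)
qed

end

theory Submission
  imports Defs "HOL-Computational_Algebra.Field_as_Ring"
begin

text \<open>
  Write \<open>a\<^sub>k\<close> for the Laurent coefficients of \<open>R\<close>. The equation
  \<open>frakF R = R\<close> says \<open>a\<^sub>2\<^sub>k\<^sub>+\<^sub>1 = a\<^sub>k\<close> for all integers \<open>k\<close>, which in terms of
  \<open>b\<^sub>n = a\<^sub>n\<^sub>-\<^sub>1\<close> is invariance under doubling: \<open>b\<^sub>2\<^sub>n = b\<^sub>n\<close>. For \<open>1/x\<close> only
  \<open>b\<^sub>0\<close> is nonzero, and for \<open>f\<^sub>r\<^sub>,\<^sub>n\<close> the number \<open>b\<^sub>j\<close> with \<open>j > 0\<close> is the sum of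
  \<open>\<lambda>\<^sup>m\<^sup>j\<close> over a set of residues \<open>m\<close> that doubling permutes, so both are fixed
  (\<open>frakF_span\<close>).

  For the converse, \<open>b\<^sub>n = 0\<close> for \<open>n < 0\<close>, because doubling would otherwise produce
  nonzero coefficients of arbitrarily negative index, and \<open>b\<^sub>0\<close> is accounted for by \<open>1/x\<close>. What
  remains is to see that \<open>b\<close> is periodic with an odd period \<open>N\<close> on the positive integers
  (\<open>fixed_coeffs_periodic\<close>):

  \<^item> The product of the denominator \<open>q\<close> of \<open>R\<close> in lowest terms with \<open>q(-x)\<close> has the form
    \<open>Q(x\<^sup>2)\<close>. Multiplying \<open>R\<close> by \<open>Q(x\<^sup>2)\<close> and applying \<open>odd_section\<close> shows that
    \<open>Q R\<close> is a polynomial, so \<open>q\<close> divides \<open>Q\<close>. Hence every nonzero pole of \<open>R\<close> is the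
    square of a pole, and as the set of poles is finite, all of them are roots of unity of odd order.
    So \<open>q\<close> divides a power of \<open>x (1 - x\<^sup>N)\<close> for some odd \<open>N\<close>
    (\<open>denominator_dvd_power\<close>).

  \<^item> Consequently \<open>k \<mapsto> b\<^sub>n\<^sub>+\<^sub>N\<^sub>k\<close> agrees with a polynomial for large \<open>k\<close>
    (\<open>coeffs_along_progression\<close>). Poles of higher order are excluded by recurrence: since
    \<open>2\<^sup>s \<equiv> 1\<close> modulo \<open>N\<close> for arbitrarily large \<open>s\<close>, doubling moves each term of
    this progression to infinitely many later terms of the same progression, so the polynomial takes
    each of the values infinitely often. It is constant and equal to every value of the progression
    (\<open>doubling_invariant_imp_periodic\<close>).

  Finally, expand the \<open>N\<close>-periodic sequence as \<open>b\<^sub>n = \<Sum>\<^sub>m c\<^sub>m \<lambda>\<^sup>m\<^sup>n\<close>.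
  Doubling invariance of \<open>b\<close> becomes doubling invariance of \<open>c\<close>
  (\<open>finite_fourier_doubling\<close>), so \<open>c\<close> is constant on cyclotomic cosets modulo \<open>N\<close>,
  and collecting the terms coset by coset writes \<open>R\<close> as a combination of \<open>1/x\<close> and the
  functions \<open>f\<^sub>N\<^sub>,\<^sub>n\<close> (\<open>frakF_fixed_in_span\<close>).
\<close>

section \<open>Laurent coefficients and the fixed-point equation\<close>

lemma laurent_zero: "laurent 0 = 0"
  using laurent_Fract[of 1 0] by (simp add: Zero_fract_def)

lemma laurent_add: "laurent (R + S) = laurent R + laurent S"
proof -
  obtain p q where R: "R = Fract p q" "q \<noteq> 0" by (cases R)
  obtain u v where S: "S = Fract u v" "v \<noteq> 0" by (cases S)
  have "fls_of_poly q \<noteq> 0" "fls_of_poly v \<noteq> 0"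
    using R S by (simp_all only: fls_of_poly_eq_0_iff not_False_eq_True)
  moreover have "R + S = Fract (p * v + u * q) (q * v)" "q * v \<noteq> 0"
    using R S by simp_all
  ultimately show ?thesis
    by (simp add: R S laurent_Fract fls_of_poly_mult fls_of_poly_add add_frac_eq
        del: fps_to_fls_plus fps_to_fls_eq_0_iff)
qed

lemma laurent_scale: "laurent (ratfun_scale c R) = fls_const c * laurent R"
proof -
  obtain p q where R: "R = Fract p q" "q \<noteq> 0" by (cases R)
  have "ratfun_scale c R = Fract ([:c:] * p) q"
    by (simp add: R ratfun_scale_def)
  thus ?thesis
    using R by (simp add: laurent_Fract fls_of_poly_mult fls_of_poly_pCons
       del: mult_pCons_left)
qed

lemma laurent_sum: "laurent (\<Sum>i\<in>I. f i) = (\<Sum>i\<in>I. laurent (f i))"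
  by (induction I rule: infinite_finite_induct) (simp_all add: laurent_zero laurent_add)

lemma laurent_inverse_X_nth:
  "fls_nth (laurent (Fract 1 [:0, 1:])) k = (if k = -1 then 1 else 0)"
proof -
  have "laurent (Fract 1 [:0, 1:]) = 1 / fls_X"
    by (simp add: laurent_Fract fls_of_poly_pCons)
  also have "\<dots> = fls_X_inv"
    by (simp add: fls_inverse_X divide_inverse)
  finally show ?thesis by simp
qed

lemma laurent_geometric_nth:
  "fls_nth (laurent (Fract [:c:] [:1, - c:])) k = (if k < 0 then 0 else c ^ nat (k + 1))"
proof -
  define g where "g = Abs_fps (\<lambda>n. c ^ Suc n)"
  have "g * fps_of_poly [:1, - c:] = fps_of_poly [:c:]"
  proof (rule fps_ext)
    fix n
    have "g * fps_of_poly [:1, - c:] = g - fps_const c * (g * fps_X)"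
      by (simp add: fps_of_poly_pCons algebra_simps flip: fps_const_neg)
    thus "fps_nth (g * fps_of_poly [:1, - c:]) n = fps_nth (fps_of_poly [:c:]) n"
      by (cases n) (simp_all add: fps_of_poly_pCons g_def)
  qed
  hence "fps_to_fls g * fls_of_poly [:1, - c:] = fls_of_poly [:c:]"
    by (metis fls_times_fps_to_fls)
  moreover have "fls_of_poly [:1, - c:] \<noteq> 0"
    by (simp only: fls_of_poly_eq_0_iff) simp
  ultimately have "laurent (Fract [:c:] [:1, - c:]) = fps_to_fls g"
    by (simp add: laurent_Fract divide_eq_eq del: fps_to_fls_eq_0_iff)
  thus ?thesis by (simp add: g_def nat_add_distrib)
qed

lemma frakF_fixed_iff:
  "frakF R = R \<longleftrightarrow> (\<forall>k. fls_nth (laurent R) (2 * k + 1) = fls_nth (laurent R) k)"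
proof -
  have "frakF R = R \<longleftrightarrow> odd_section (laurent R) = laurent R"
    using laurent_frakF[of R] frakF_unique[of R R] by auto
  thus ?thesis by (simp add: fls_eq_iff odd_section_nth)
qed

text \<open>
  If the lowest exponent \<open>d\<close> were below \<open>-1\<close>, then \<open>2 d + 1 < d\<close> would be the
  exponent of another nonzero term. At \<open>-1\<close> the map \<open>k \<mapsto> 2 k + 1\<close> has its fixed point,
  which is why \<open>1/x\<close> can occur.
\<close>

lemma fixed_coeffs_below_minus_one:
  assumes "\<And>k. fls_nth L (2 * k + 1) = fls_nth L k" "k < -1"
  shows "fls_nth L k = 0"
proof (rule ccontr)
  assume "fls_nth L k \<noteq> 0"
  hence "fls_subdegree L < -1" "L \<noteq> 0"
    using fls_subdegree_leI[of L k] assms(2) by auto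
  moreover from this have "fls_nth L (fls_subdegree L) \<noteq> 0" by simp
  hence "fls_nth L (2 * fls_subdegree L + 1) \<noteq> 0" using assms(1) by simp
  hence "fls_subdegree L \<le> 2 * fls_subdegree L + 1" by (rule fls_subdegree_leI)
  ultimately show False by linarith
qed

section \<open>Cyclotomic cosets\<close>

lemma periodic_mod:
  fixes f :: "nat \<Rightarrow> 'a"
  assumes "\<And>n. f (n + r) = f n"
  shows "f (n mod r) = f n"
proof -
  have "f (m + k * r) = f m" for m k
  proof (induction k)
    case (Suc k)
    have "f (m + Suc k * r) = f ((m + k * r) + r)" by (simp add: algebra_simps)
    thus ?case using assms Suc by simp
  qed simp
  from this[of "n mod r" "n div r"] show ?thesis by simp
qed

lemma root_of_unity_power_mod:
  fixes z :: complex
  assumes "z ^ r = 1"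
  shows "z ^ (n mod r) = z ^ n"
  by (rule periodic_mod) (simp add: power_add assms)

text \<open>
  Negative powers of \<open>2\<close> give nothing new: by Euler's theorem the inverse of \<open>2\<close> modulo
  \<open>r\<close> is itself the positive power with exponent \<open>totient r - 1\<close>.
\<close>

lemma cyc_coset_eq:
  assumes "odd r"
  shows "cyc_coset r n = {2 ^ s * n mod r |s. True}"
proof (intro equalityI subsetI)
  fix m assume "m \<in> cyc_coset r n"
  then obtain s where m: "m = nat ((two_powi_mod r s * int n) mod int r)"
    by (auto simp: cyc_coset_def)
  have "\<exists>t. [two_powi_mod r s = 2 ^ t] (mod int r)"
  proof (cases "0 \<le> s")
    case True
    thus ?thesis by (auto simp: two_powi_mod_def cong_def)
  next
    case False
    have cop: "coprime 2 (int r)" using assms by simp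
    have r: "totient r > 0" using assms by (simp add: odd_pos)
    define v where "v = modular_inverse (int r) 2"
    have "[2 * v = 1] (mod int r)"
      unfolding v_def by (rule cong_modular_inverse1) (use cop in simp)
    moreover have "[2 * 2 ^ (totient r - 1) = (1 :: int)] (mod int r)"
    proof -
      have "[2 ^ totient r = (1::nat)] (mod r)"
        by (rule euler_theorem) (use assms in simp)
      hence "[int (2 ^ totient r) = int 1] (mod int r)"
        by (subst cong_int_iff)
      thus ?thesis using r by (simp add: power_eq_if[of _ "totient r"])
    qed
    ultimately have "[2 * v = 2 * 2 ^ (totient r - 1)] (mod int r)"
      by (metis cong_sym cong_trans)
    hence "[v = 2 ^ (totient r - 1)] (mod int r)"
      using cop cong_mult_lcancel by blast
    hence "[v ^ nat (- s) = (2 ^ (totient r - 1)) ^ nat (- s)] (mod int r)"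
      by (rule cong_pow)
    hence "[two_powi_mod r s = 2 ^ ((totient r - 1) * nat (- s))] (mod int r)"
      using False by (simp add: two_powi_mod_def v_def cong_def power_mult)
    thus ?thesis by blast
  qed
  then obtain t where "[two_powi_mod r s = 2 ^ t] (mod int r)" by blast
  hence "[two_powi_mod r s * int n = 2 ^ t * int n] (mod int r)"
    by (rule cong_scalar_right)
  hence "m = nat (int (2 ^ t * n mod r))"
    unfolding m by (simp add: cong_def zmod_int)
  hence "m = 2 ^ t * n mod r" by (simp only: nat_int)
  thus "m \<in> {2 ^ s * n mod r |s. True}" by blast
next
  fix m assume "m \<in> {2 ^ s * n mod r |s. True}"
  then obtain s where "m = 2 ^ s * n mod r" by blast
  hence "int m = (two_powi_mod r (int s) * int n) mod int r"
    by (simp add: two_powi_mod_def zmod_int mod_mult_left_eq)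
  hence "m = nat ((two_powi_mod r (int s) * int n) mod int r)"
    by (metis nat_int)
  thus "m \<in> cyc_coset r n" unfolding cyc_coset_def by blast
qed

lemma cyc_coset_subset: "odd r \<Longrightarrow> cyc_coset r n \<subseteq> {..<r}"
  by (auto simp: cyc_coset_eq odd_pos)

lemma double_mem_cyc_coset:
  assumes "odd r" "m \<in> cyc_coset r n"
  shows "2 * m mod r \<in> cyc_coset r n"
proof -
  obtain s where "m = 2 ^ s * n mod r" using assms by (auto simp: cyc_coset_eq)
  hence "2 * m mod r = 2 ^ Suc s * n mod r" by (simp add: mod_mult_right_eq mult.assoc)
  thus ?thesis unfolding cyc_coset_eq[OF assms(1)] by blast
qed

lemma bij_betw_double_mod:
  fixes r :: nat
  assumes "odd r" "C \<subseteq> {..<r}" "\<And>m. m \<in> C \<Longrightarrow> 2 * m mod r \<in> C"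
  shows "bij_betw (\<lambda>m. 2 * m mod r) C C"
proof -
  have "inj_on (\<lambda>m. 2 * m mod r) C"
  proof (rule inj_onI)
    fix a b assume ab: "a \<in> C" "b \<in> C" "2 * a mod r = 2 * b mod r"
    hence "[2 * a = 2 * b] (mod r)" by (simp add: cong_def)
    hence "[a = b] (mod r)" using assms(1) by (simp add: cong_mult_lcancel_nat)
    moreover have "a < r" "b < r" using ab assms(2) by auto
    ultimately show "a = b" by (simp add: cong_def)
  qed
  moreover have "finite C" using assms(2) finite_subset by blast
  ultimately show ?thesis
    using assms(3) endo_inj_surj[of C "\<lambda>m. 2 * m mod r"] by (auto simp: bij_betw_def)
qed

lemma self_mem_cyc_coset:
  assumes "odd r" "n < r"
  shows "n \<in> cyc_coset r n"
proof -
  have "n = 2 ^ 0 * n mod r" using assms(2) by simp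
  thus ?thesis unfolding cyc_coset_eq[OF assms(1)] by blast
qed

text \<open>
  Inclusion in one direction is composition of powers of \<open>2\<close>; for the other, some power of
  \<open>2\<close> leads back from \<open>m\<close> to \<open>n\<close>, because \<open>2\<close> has finite order modulo \<open>r\<close>.
\<close>

lemma cyc_coset_eq_of_mem:
  assumes "odd r" "n < r" "m \<in> cyc_coset r n"
  shows "cyc_coset r m = cyc_coset r n"
proof -
  have sub: "cyc_coset r m' \<subseteq> cyc_coset r n'" if m': "m' \<in> cyc_coset r n'" for m' n'
  proof -
    obtain s where "m' = 2 ^ s * n' mod r" using m' by (auto simp: cyc_coset_eq[OF assms(1)])
    hence "2 ^ t * m' mod r = 2 ^ (t + s) * n' mod r" for t
      by (simp add: mod_mult_right_eq power_add mult.assoc)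
    thus ?thesis unfolding cyc_coset_eq[OF assms(1)] by blast
  qed
  obtain s where s: "m = 2 ^ s * n mod r"
    using assms(3) by (auto simp: cyc_coset_eq[OF assms(1)])
  have "[(2 ^ totient r) ^ s = 1 ^ s] (mod r)"
    using assms(1) by (intro cong_pow euler_theorem) simp
  hence "[(2 ^ totient r) ^ s * n = 1 ^ s * n] (mod r)" by (rule cong_scalar_right)
  hence "2 ^ (totient r * s) * n mod r = n"
    using \<open>n < r\<close> by (simp add: cong_def power_mult)
  moreover have "totient r * s = (totient r - 1) * s + s"
  proof -
    have "totient r = Suc (totient r - 1)" using assms(1) by (simp add: odd_pos)
    thus ?thesis by (metis mult_Suc add.commute)
  qed
  ultimately have "2 ^ ((totient r - 1) * s) * m mod r = n"
    unfolding s by (simp add: power_add mult.assoc mod_mult_right_eq)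
  hence "n \<in> cyc_coset r m" unfolding cyc_coset_eq[OF assms(1)] by blast
  thus ?thesis using sub assms(3) by blast
qed

text \<open>
  A sum with weights constant on cosets is a combination of the sums over single cosets. Summing over
  all \<open>n < r\<close> uses every coset \<open>C\<close> exactly \<open>card C\<close> times; dividing by the
  cardinality compensates for this and avoids choosing representatives.
\<close>

lemma sum_over_cyc_cosets:
  fixes c h :: "nat \<Rightarrow> complex"
  assumes "odd r" and c: "\<And>m n. m \<in> cyc_coset r n \<Longrightarrow> c m = c n"
  shows "(\<Sum>n<r. c n / of_nat (card (cyc_coset r n)) * (\<Sum>m\<in>cyc_coset r n. h m)) =
         (\<Sum>m<r. c m * h m)"
proof -
  let ?w = "\<lambda>n. of_nat (card (cyc_coset r n)) :: complex"
  have mem: "m < r \<and> n \<in> cyc_coset r m" if "n < r" "m \<in> cyc_coset r n" for m n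
    using that self_mem_cyc_coset[OF assms(1) \<open>n < r\<close>] cyc_coset_eq_of_mem[OF assms(1)]
      cyc_coset_subset[OF assms(1)] by blast
  have fin: "finite (cyc_coset r n)" for n
    using assms(1) by (simp add: finite_cyc_coset odd_pos)
  have "(\<Sum>n<r. c n / ?w n * (\<Sum>m\<in>cyc_coset r n. h m)) =
        (\<Sum>n<r. \<Sum>m\<in>{m \<in> {..<r}. n \<in> cyc_coset r m}. c n / ?w n * h m)"
    unfolding sum_distrib_left
  proof (intro sum.cong)
    fix n assume "n \<in> {..<r}"
    thus "cyc_coset r n = {m \<in> {..<r}. n \<in> cyc_coset r m}"
      using mem by blast
  qed simp_all
  \<comment> \<open>Membership in a common coset is symmetric, so the order of summation can be exchanged.\<close>
  also have "\<dots> = (\<Sum>m<r. \<Sum>n\<in>{n \<in> {..<r}. n \<in> cyc_coset r m}. c n / ?w n * h m)"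
    by (rule sum.swap_restrict) simp_all
  also have "\<dots> = (\<Sum>m<r. \<Sum>n\<in>cyc_coset r m. c m / ?w m * h m)"
  proof (intro sum.cong)
    fix m assume m: "m \<in> {..<r}"
    show "{n \<in> {..<r}. n \<in> cyc_coset r m} = cyc_coset r m"
      using cyc_coset_subset[OF assms(1)] by blast
    fix n assume "n \<in> cyc_coset r m"
    hence "c n = c m" "cyc_coset r n = cyc_coset r m"
      using c cyc_coset_eq_of_mem[OF assms(1)] m by auto
    thus "c n / ?w n * h m = c m / ?w m * h m" by simp
  qed simp_all
  also have "\<dots> = (\<Sum>m<r. c m * h m)"
  proof (intro sum.cong)
    fix m assume "m \<in> {..<r}"
    hence "card (cyc_coset r m) > 0"
      using fin self_mem_cyc_coset[OF assms(1)] by (auto simp: card_gt_0_iff)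
    thus "(\<Sum>n\<in>cyc_coset r m. c m / ?w m * h m) = c m * h m" by simp
  qed simp_all
  finally show ?thesis .
qed

section \<open>The combinations of the generators are fixed\<close>

lemma cyc_fun_nth:
  "fls_nth (laurent (cyc_fun lam r n)) k =
     (if k < 0 then 0 else \<Sum>m\<in>cyc_coset r n. lam r ^ (m * nat (k + 1)))"
  by (simp add: cyc_fun_def laurent_sum fls_nth_sum laurent_geometric_nth power_mult)

text \<open>
  Replacing \<open>k\<close> by \<open>2 k + 1\<close> doubles the exponent \<open>k + 1\<close> in each term of the
  coefficient, which amounts to reindexing the coset by the permutation \<open>m \<mapsto> 2 m mod r\<close>.
\<close>

lemma frakF_cyc_fun:
  assumes "odd r" "lam r ^ r = 1"
  shows "frakF (cyc_fun lam r n) = cyc_fun lam r n"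
  unfolding frakF_fixed_iff
proof
  fix k :: int
  let ?C = "cyc_coset r n" and ?z = "lam r"
  have "(\<Sum>m\<in>?C. ?z ^ (m * nat (2 * k + 1 + 1))) = (\<Sum>m\<in>?C. ?z ^ (m * nat (k + 1)))"
    if "k \<ge> 0"
  proof -
    have "(\<Sum>m\<in>?C. ?z ^ (m * nat (k + 1))) =
          (\<Sum>m\<in>?C. ?z ^ ((2 * m mod r) * nat (k + 1)))"
      using bij_betw_double_mod[OF assms(1) cyc_coset_subset[OF assms(1)]
          double_mem_cyc_coset[OF assms(1)]]
      by (rule sum.reindex_bij_betw[symmetric])
    also have "\<dots> = (\<Sum>m\<in>?C. ?z ^ (m * nat (2 * k + 1 + 1)))"
    proof (rule sum.cong)
      fix m assume "m \<in> ?C"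
      have "m * nat (2 * k + 1 + 1) = 2 * m * nat (k + 1)"
        using that by (simp add: nat_add_distrib nat_mult_distrib algebra_simps)
      thus "?z ^ ((2 * m mod r) * nat (k + 1)) = ?z ^ (m * nat (2 * k + 1 + 1))"
        by (simp only: power_mult root_of_unity_power_mod[OF assms(2)])
    qed simp
    finally show ?thesis by simp
  qed
  thus "fls_nth (laurent (cyc_fun lam r n)) (2 * k + 1) = fls_nth (laurent (cyc_fun lam r n)) k"
    by (simp add: cyc_fun_nth)
qed

lemma subspace_frakF_fixed: "ratfun.subspace {R. frakF R = R}"
  unfolding ratfun.subspace_def
  by (simp add: frakF_fixed_iff laurent_zero laurent_add laurent_scale)

lemma frakF_span:
  assumes "\<And>r. odd r \<Longrightarrow> lam r ^ r = 1"
    and "R \<in> ratfun.span (insert (Fract 1 [:0, 1:]) {cyc_fun lam r n |r n. odd r \<and> n \<le> r - 1})"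
  shows "frakF R = R"
proof -
  have "frakF (Fract 1 [:0, 1:]) = Fract 1 [:0, 1:]"
    by (simp add: frakF_fixed_iff laurent_inverse_X_nth)
  hence "insert (Fract 1 [:0, 1:]) {cyc_fun lam r n |r n. odd r \<and> n \<le> r - 1} \<subseteq> {R. frakF R = R}"
    using frakF_cyc_fun assms(1) by auto
  thus ?thesis
    using ratfun.span_minimal[OF _ subspace_frakF_fixed] assms(2) by blast
qed

section \<open>The poles of a fixed rational function\<close>

lemma ex_odd_section_fls_of_poly: "\<exists>v. odd_section (fls_of_poly u) = fls_of_poly v"
proof -
  obtain a b where u: "u = pcompose a [:0, 0, 1:] + [:0, 1:] * pcompose b [:0, 0, 1:]"
    using poly_even_odd_split by blast
  have "fls_of_poly u = 1 * fls_of_poly (pcompose a [:0, 0, 1:]) +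
          fls_X * fls_of_poly (pcompose b [:0, 0, 1:])"
    unfolding u fls_of_poly_add fls_of_poly_mult by simp
  moreover have "odd_section 1 = 0"
    by (intro fls_eqI) (simp add: odd_section_nth, presburger)
  moreover have "odd_section fls_X = 1"
    by (intro fls_eqI) (simp add: odd_section_nth)
  ultimately have "odd_section (fls_of_poly u) = fls_of_poly b"
    by (simp only: odd_section_add odd_section_mult_pcompose) simp
  thus ?thesis by blast
qed

text \<open>
  The polynomial \<open>q(x) q(-x)\<close> is even, and the roots of \<open>Q\<close> are the squares of the roots of
  \<open>q\<close>.
\<close>

lemma ex_root_squaring_poly:
  fixes q :: "complex poly"
  shows "\<exists>Q. pcompose Q [:0, 0, 1:] = q * pcompose q [:0, -1:]"
proof -
  obtain c d where q: "q = pcompose c [:0, 0, 1:] + [:0, 1:] * pcompose d [:0, 0, 1:]"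
    using poly_even_odd_split by blast
  have q': "pcompose q [:0, -1:] = pcompose c [:0, 0, 1:] - [:0, 1:] * pcompose d [:0, 0, 1:]"
    unfolding q by (simp add: pcompose_add pcompose_mult pcompose_pCons flip: pcompose_assoc)
  have X2: "pcompose [:0, 1:] [:0, 0, 1 :: complex:] = [:0, 1:] * [:0, 1:]"
    by (simp add: pcompose_pCons)
  have "pcompose (c * c - [:0, 1:] * (d * d)) [:0, 0, 1:] = q * pcompose q [:0, -1:]"
    unfolding q' unfolding q pcompose_diff pcompose_mult X2 by (simp only: algebra_simps)
  thus ?thesis by blast
qed

text \<open>
  With \<open>L = p / q\<close> one has \<open>L Q(x\<^sup>2) = p(x) q(-x)\<close>, a polynomial. Taking odd sections,
  which commutes with the factor \<open>Q(x\<^sup>2)\<close> up to turning it into \<open>Q\<close> and fixes \<open>L\<close>, shows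
  that \<open>L Q\<close> is a polynomial too; so \<open>q\<close> divides \<open>p Q\<close>, hence \<open>Q\<close>.
\<close>

lemma denominator_dvd_root_squaring_poly:
  assumes L: "odd_section L = L" "L * fls_of_poly q = fls_of_poly p"
    and "coprime p q" and Q: "pcompose Q [:0, 0, 1:] = q * pcompose q [:0, -1:]"
  shows "q dvd Q"
proof -
  obtain v where v: "odd_section (fls_of_poly (p * pcompose q [:0, -1:])) = fls_of_poly v"
    using ex_odd_section_fls_of_poly by blast
  have "L * fls_of_poly (pcompose Q [:0, 0, 1:]) = fls_of_poly (p * pcompose q [:0, -1:])"
    unfolding Q fls_of_poly_mult L(2)[symmetric] by (simp only: mult.assoc)
  hence "L * fls_of_poly Q = fls_of_poly v"
    using odd_section_mult_pcompose[of L Q] L(1) v by simp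
  hence "fls_of_poly (p * Q) = fls_of_poly (q * v)"
    unfolding fls_of_poly_mult L(2)[symmetric] by (metis mult.assoc mult.commute)
  hence "p * Q = q * v" by (simp only: fls_of_poly_eq_iff)
  hence "q dvd p * Q" by simp
  moreover have "coprime q p" using \<open>coprime p q\<close> by (rule coprime_imp_coprime)
  ultimately show ?thesis by (simp only: coprime_dvd_mult_right_iff)
qed

text \<open>
  Take square roots inside \<open>P\<close> again and again, starting at \<open>a\<close>. As \<open>P\<close> is finite, the
  chain meets some element twice, say \<open>d\<close> steps apart. That element is fixed by \<open>d\<close>-fold
  squaring, and therefore so is \<open>a\<close>, which is an iterated square of it. Thus \<open>a\<close> to the power
  \<open>2\<^sup>d - 1\<close> is \<open>1\<close>.
\<close>

lemma odd_order_of_square_in_finite_set: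
  fixes P :: "complex set"
  assumes "finite P" "0 \<notin> P" and sqrt: "\<And>a. a \<in> P \<Longrightarrow> \<exists>b\<in>P. b ^ 2 = a" and "a \<in> P"
  shows "\<exists>N. odd N \<and> a ^ N = 1"
proof -
  have "\<exists>b. \<forall>n. b n \<in> P \<and> b (Suc n) ^ 2 = b n \<and> (n = 0 \<longrightarrow> b n = a)"
    using dependent_nat_choice[of "\<lambda>n x. x \<in> P \<and> (n = 0 \<longrightarrow> x = a)" "\<lambda>n x y. y ^ 2 = x"]
      sqrt \<open>a \<in> P\<close> by blast
  then obtain b where b: "\<And>n. b n \<in> P" "\<And>n. b (Suc n) ^ 2 = b n" "b 0 = a" by metis
  have pow: "b (i + d) ^ (2 ^ d) = b i" for i d
  proof (induction d)
    case (Suc d)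
    have "b (i + Suc d) ^ (2 ^ Suc d) = (b (Suc (i + d)) ^ 2) ^ (2 ^ d)"
      by (simp flip: power_mult)
    thus ?case using b(2) Suc by simp
  qed simp
  have "\<not> inj b"
    using b(1) finite_subset[of "range b" P] \<open>finite P\<close> finite_imageD by blast
  then obtain i j where "b i = b j" "i < j"
    unfolding inj_on_def by (metis linorder_neqE_nat)
  define d where "d = j - i"
  have d: "d > 0" "b (i + d) = b i" using \<open>i < j\<close> \<open>b i = b j\<close> by (simp_all add: d_def)
  have a: "a = b i ^ (2 ^ i)" using pow[of 0 i] b(3) by simp
  have "a ^ (2 ^ d) = (b i ^ (2 ^ d)) ^ (2 ^ i)"
    unfolding a by (simp add: mult.commute flip: power_mult)
  also have "\<dots> = a" using pow[of i d] d a by simp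
  finally have "a * a ^ (2 ^ d - 1) = a * 1"
    by (simp flip: power_Suc)
  hence "a ^ (2 ^ d - 1) = 1"
    using \<open>a \<in> P\<close> \<open>0 \<notin> P\<close> by auto
  moreover have "odd (2 ^ d - 1 :: nat)" using d by simp
  ultimately show ?thesis by blast
qed

lemma common_odd_order:
  fixes P :: "complex set"
  assumes "finite P" and "\<And>a. a \<in> P \<Longrightarrow> \<exists>N. odd N \<and> a ^ N = 1"
  shows "\<exists>N. odd N \<and> (\<forall>a\<in>P. a ^ N = 1)"
  using assms
proof (induction P rule: finite_induct)
  case empty
  show ?case by (intro exI[of _ 1]) simp
next
  case (insert x P)
  obtain N where "odd N" "\<forall>a\<in>P. a ^ N = 1" using insert.IH insert.prems by blast
  moreover obtain M where "odd M" "x ^ M = 1" using insert.prems by blast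
  ultimately have "odd (M * N)" "x ^ (M * N) = 1" "\<forall>a\<in>P. a ^ (N * M) = 1"
    by (simp_all add: power_mult)
  thus ?case by (intro exI[of _ "M * N"]) (auto simp: mult.commute)
qed

text \<open>
  The nonzero roots of \<open>q\<close> are squares of roots of \<open>q\<close>, hence roots of unity of odd
  order, and all roots of \<open>q\<close> are roots of \<open>x (1 - x\<^sup>N)\<close> for a common odd \<open>N\<close>.
  Multiplicities are absorbed into the exponent \<open>M\<close>. The factor \<open>x\<close> is needed for a possible
  pole at the origin.
\<close>

lemma denominator_dvd_power:
  assumes "odd_section L = L" "L * fls_of_poly q = fls_of_poly p" "coprime p q" "q \<noteq> 0"
  shows "\<exists>N M. odd N \<and> q dvd ([:0, 1:] * (1 - Polynomial.monom 1 N)) ^ M"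
proof -
  obtain Q where Q: "pcompose Q [:0, 0, 1:] = q * pcompose q [:0, -1:]"
    using ex_root_squaring_poly by blast
  have "q dvd Q" using denominator_dvd_root_squaring_poly[OF assms(1-3) Q] .
  define P where "P = {a. poly q a = 0} - {0}"
  have fin: "finite P" using \<open>q \<noteq> 0\<close> by (simp add: P_def poly_roots_finite)
  have "\<exists>b\<in>P. b ^ 2 = a" if "a \<in> P" for a
  proof -
    have "poly Q a = 0" using that \<open>q dvd Q\<close> by (auto simp: P_def elim: dvdE)
    moreover have "poly Q (csqrt a ^ 2) = poly q (csqrt a) * poly q (- csqrt a)"
      using arg_cong[OF Q, of "\<lambda>f. poly f (csqrt a)"]
      by (simp add: poly_pcompose power2_eq_square)
    ultimately have "poly q (csqrt a) = 0 \<or> poly q (- csqrt a) = 0" by simp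
    moreover have "a \<noteq> 0" using that by (simp add: P_def)
    ultimately show ?thesis
      by (auto simp: P_def intro: bexI[of _ "csqrt a"] bexI[of _ "- csqrt a"])
  qed
  hence "\<exists>N. odd N \<and> a ^ N = 1" if "a \<in> P" for a
    using odd_order_of_square_in_finite_set[OF fin _ _ that] by (auto simp: P_def)
  then obtain N where N: "odd N" "\<forall>a\<in>P. a ^ N = 1"
    using common_odd_order[OF fin] by blast
  have "\<forall>x. poly q x = 0 \<longrightarrow> poly ([:0, 1:] * (1 - Polynomial.monom 1 N)) x = 0"
    using N(2) by (auto simp: P_def poly_monom)
  hence "q dvd ([:0, 1:] * (1 - Polynomial.monom 1 N)) ^ degree q"
    using nullstellensatz_univariate \<open>q \<noteq> 0\<close> by blast
  thus ?thesis using N(1) by blast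
qed

section \<open>Coefficients along arithmetic progressions\<close>

lemma fls_of_poly_power: "fls_of_poly (p ^ n) = fls_of_poly p ^ n"
  by (induction n) (simp_all add: fls_of_poly_mult)

text \<open>
  The factor \<open>x\<^sup>M\<close> only shifts indices, so it can be dropped from a statement about all
  sufficiently large indices.
\<close>

lemma coeff_recurrence_of_poly_multiple:
  assumes "L * fls_of_poly (([:0, 1:] * (1 - Polynomial.monom 1 N)) ^ M) = fls_of_poly p"
  shows "\<exists>K. \<forall>k\<ge>K. fls_nth ((1 - fls_X ^ N) ^ M * L) k = 0"
proof -
  have "fls_of_poly [:0, 1:] = fls_X" "fls_of_poly (1 - Polynomial.monom 1 N) = 1 - fls_X ^ N"
    by (simp_all add: fps_of_poly_diff fps_of_poly_monom fps_to_fls_power)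
  hence "fls_X ^ M * ((1 - fls_X ^ N) ^ M * L) = fls_of_poly p"
    using assms by (simp only: fls_of_poly_power fls_of_poly_mult power_mult_distrib mult_ac)
  hence eq: "fls_nth ((1 - fls_X ^ N) ^ M * L) (k - int M) = fls_nth (fls_of_poly p) k" for k
    by (simp add: fls_X_power_times_conv_shift fls_eq_iff)
  have "fls_nth ((1 - fls_X ^ N) ^ M * L) k = 0" if "k \<ge> int (Suc (degree p))" for k
    using eq[of "k + int M"] that by (simp add: coeff_eq_0)
  thus ?thesis by blast
qed

text \<open>
  By Pascal's rule the binomial coefficient \<open>k choose (i + 1)\<close> is a discrete primitive of
  \<open>k choose i\<close>. This makes binomial coefficients a more convenient basis than monomials for the
  polynomials that arise from iterated differences.
\<close>

lemma sum_of_binomials: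
  fixes f :: "nat \<Rightarrow> complex"
  assumes "\<And>k. k \<ge> K \<Longrightarrow> f (Suc k) - f k = (\<Sum>i<m. c i * of_nat (k choose i))"
  shows "\<exists>c' m'. \<forall>k\<ge>K. f k = (\<Sum>i<m'. c' i * of_nat (k choose i))"
proof -
  define S where "S k = (\<Sum>i<m. c i * of_nat (k choose Suc i))" for k
  have S_Suc: "S (Suc k) = S k + (\<Sum>i<m. c i * of_nat (k choose i))" for k
    by (simp add: S_def algebra_simps sum.distrib)
  have "f k = (f K - S K) + S k" if "k \<ge> K" for k
    using that
  proof (induction k rule: dec_induct)
    case (step k)
    have "f (Suc k) - f k = S (Suc k) - S k"
      using assms[of k] step.hyps(1) S_Suc[of k] by simp
    thus ?case using step.IH by (simp add: algebra_simps)
  qed simp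
  \<comment> \<open>The constant of summation becomes the coefficient of \<open>k choose 0\<close>.\<close>
  also have "(f K - S K) + S k =
      (\<Sum>i<Suc m. (case i of 0 \<Rightarrow> f K - S K | Suc j \<Rightarrow> c j) * of_nat (k choose i))" for k
    by (subst sum.lessThan_Suc_shift) (simp add: S_def)
  finally show ?thesis by blast
qed

text \<open>
  Multiplication by \<open>1 - x\<^sup>N\<close> takes differences along progressions with step \<open>N\<close>.
  So if the \<open>M\<close>-th difference vanishes for large indices, then each such progression eventually
  follows a polynomial, by \<open>M\<close> summations.
\<close>

lemma coeffs_along_progression:
  assumes "N > 0" "\<forall>k\<ge>K. fls_nth ((1 - fls_X ^ N) ^ M * L :: complex fls) k = 0"
  shows "\<exists>c m k0. \<forall>k\<ge>k0. fls_nth L (a + int N * int k) = (\<Sum>i<m. c i * of_nat (k choose i))"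
  using assms(2)
proof (induction M arbitrary: L a)
  case 0
  have "fls_nth L (a + int N * int k) = 0" if "k \<ge> nat (K - a)" for k
  proof -
    have "1 * int k \<le> int N * int k" using \<open>N > 0\<close> by (intro mult_right_mono) auto
    thus ?thesis using 0 that by auto
  qed
  thus ?case by (intro exI[of _ "\<lambda>_. 0"] exI[of _ 0] exI[of _ "nat (K - a)"]) auto
next
  case (Suc M)
  let ?H = "1 - fls_X ^ N :: complex fls"
  have "\<forall>k\<ge>K. fls_nth (?H ^ M * (?H * L)) k = 0"
    using Suc.prems by (simp only: power_Suc mult_ac)
  \<comment> \<open>The coefficient of \<open>?H * L\<close> at \<open>n\<close> is a backward difference of \<open>L\<close>, so the hypothesis is
    used for the progression that starts one step later.\<close>
  from Suc.IH[OF this, of "a + int N"] obtain c m k0 where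
    *: "\<And>k. k \<ge> k0 \<Longrightarrow>
      fls_nth (?H * L) (a + int N + int N * int k) = (\<Sum>i<m. c i * of_nat (k choose i))"
    by blast
  define f where "f k = fls_nth L (a + int N * int k)" for k
  have nth: "fls_nth (?H * L) n = fls_nth L n - fls_nth L (n - int N)" for n
    by (simp add: left_diff_distrib fls_X_power_times_conv_shift)
  have "f (Suc k) - f k = (\<Sum>i<m. c i * of_nat (k choose i))" if "k \<ge> k0" for k
    using *[OF that] unfolding nth f_def by (simp add: algebra_simps)
  from sum_of_binomials[of k0 f c m, OF this] show ?case
    unfolding f_def by blast
qed

lemma binomial_sum_is_poly:
  "\<exists>Q :: complex poly. \<forall>k. poly Q (of_nat k) = (\<Sum>i<m. c i * of_nat (k choose i))"
proof -
  define B :: "nat \<Rightarrow> complex poly"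
    where "B i = Polynomial.smult (1 / fact i) (\<Prod>j = 0..<i. [:- of_nat j, 1:])" for i
  have "poly (B i) (of_nat k) = of_nat (k choose i)" for i k
    by (simp add: B_def poly_prod binomial_gbinomial gbinomial_prod_rev)
  hence "poly (\<Sum>i<m. Polynomial.smult (c i) (B i)) (of_nat k) = (\<Sum>i<m. c i * of_nat (k choose i))" for k
    by (simp add: poly_sum)
  thus ?thesis by blast
qed

section \<open>Periodicity from invariance under doubling\<close>

lemma poly_const_if_value_recurs:
  fixes Q :: "complex poly"
  assumes "\<And>m. \<exists>k\<ge>m. poly Q (of_nat k) = v"
  shows "Q = [:v:]"
proof -
  have "infinite {k. poly Q (of_nat k) = v}"
    using assms by (simp add: infinite_nat_iff_unbounded_le)
  hence "infinite (of_nat ` {k. poly Q (of_nat k) = v} :: complex set)"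
    by (simp add: finite_image_iff)
  hence "infinite {x. poly (Q - [:v:]) x = 0}"
    by (rule contrapos_nn) (auto elim!: finite_subset[rotated])
  thus ?thesis using poly_roots_finite[of "Q - [:v:]"] by auto
qed

text \<open>
  Multiplication by a power of \<open>2\<close> that is \<open>1\<close> modulo \<open>N\<close> moves the index \<open>n + N i\<close>
  to a later index of the same progression with the same value of \<open>b\<close>. There are infinitely many
  such powers, so the polynomial \<open>Q\<close> takes the value \<open>b (n + N i)\<close> infinitely often and is equal
  to it. The cases \<open>i = 0\<close> and \<open>i = 1\<close> give the claim, even for \<open>n\<close> too small for
  \<open>Q\<close> to describe \<open>b\<close> there.
\<close>

lemma doubling_invariant_imp_periodic:
  fixes b :: "nat \<Rightarrow> complex"
  assumes "odd N" "n > 0" and double: "\<And>n. b (2 * n) = b n"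
    and "\<forall>k\<ge>k0. b (n + N * k) = poly Q (of_nat k)"
  shows "b (n + N) = b n"
proof -
  have pow: "b (2 ^ s * n) = b n" for s n
    by (induction s) (simp_all add: double mult.assoc)
  have const: "Q = [:b (n + N * i):]" for i
  proof (rule poly_const_if_value_recurs)
    fix m :: nat
    \<comment> \<open>The exponent is taken so large that the quotient \<open>e\<close> below is at least \<open>k0 + m\<close>.\<close>
    define j where "j = N * (k0 + m)"
    have "[2 ^ totient N = (1 :: nat)] (mod N)"
      by (rule euler_theorem) (use \<open>odd N\<close> in simp)
    hence "[(2 ^ totient N) ^ j = 1 ^ j] (mod N)" by (rule cong_pow)
    hence "[2 ^ (totient N * j) = (1 :: nat)] (mod N)" by (simp add: power_mult)
    then obtain e where e: "(2::nat) ^ (totient N * j) = 1 + N * e"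
      using cong_to_1'_nat[of "2 ^ (totient N * j)" N] by (auto simp: mult.commute[of N])
    have "totient N > 0" using \<open>odd N\<close> by (simp add: odd_pos)
    hence "j \<le> totient N * j" by (cases "totient N") simp_all
    also have "\<dots> < 1 + N * e" unfolding e[symmetric] by (rule less_exp)
    finally have "N * (k0 + m) \<le> N * e" by (simp only: j_def)
    hence "k0 + m \<le> e" using odd_pos[OF \<open>odd N\<close>] by simp
    define k where "k = i + e * (n + N * i)"
    have "e * 1 \<le> e * (n + N * i)" using \<open>n > 0\<close> by (intro mult_le_mono2) simp
    hence "k \<ge> k0 + m" using \<open>k0 + m \<le> e\<close> unfolding k_def by linarith
    moreover have "2 ^ (totient N * j) * (n + N * i) = n + N * k"
      unfolding e k_def by (simp add: algebra_simps)
    ultimately show "\<exists>k\<ge>m. poly Q (of_nat k) = b (n + N * i)"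
      using pow[of "totient N * j" "n + N * i"] assms(4)
      by (intro exI[of _ k]) (auto simp del: of_nat_add of_nat_mult)
  qed
  show ?thesis using const[of 0] const[of 1] by simp
qed

text \<open>
  The sequence \<open>b\<^sub>n = a\<^sub>n\<^sub>-\<^sub>1\<close> is periodic from \<open>n = 1\<close> on, without a preperiod. The value at
  \<open>n = 0\<close> has to be left out, as it is the arbitrary coefficient of \<open>1/x\<close>.
\<close>

lemma fixed_coeffs_periodic:
  assumes "frakF R = R"
  shows "\<exists>N. odd N \<and> (\<forall>n>0.
    fls_nth (laurent R) (int (n + N) - 1) = fls_nth (laurent R) (int n - 1))"
proof -
  define L where "L = laurent R"
  have fixed: "fls_nth L (2 * k + 1) = fls_nth L k" for k
    using assms by (simp add: frakF_fixed_iff L_def)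
  have "odd_section L = L"
    by (intro fls_eqI) (simp add: odd_section_nth fixed)
  define p q where "p = fst (quot_of_fract R)" and "q = snd (quot_of_fract R)"
  have pq: "R = Fract p q" "coprime p q" "q \<noteq> 0"
    by (simp_all add: p_def q_def coprime_quot_of_fract Fract_quot_of_fract)
  have "L * fls_of_poly q = fls_of_poly p"
    using pq(3) by (simp add: L_def pq(1) laurent_Fract fls_of_poly_eq_0_iff
      del: fps_to_fls_eq_0_iff)
  from denominator_dvd_power[OF \<open>odd_section L = L\<close> this pq(2,3)]
  obtain N M u where N: "odd N" and u: "([:0, 1:] * (1 - Polynomial.monom 1 N)) ^ M = q * u"
    by (auto elim: dvdE)
  have "L * fls_of_poly (([:0, 1:] * (1 - Polynomial.monom 1 N)) ^ M) = fls_of_poly (p * u)"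
    unfolding u fls_of_poly_mult \<open>L * fls_of_poly q = fls_of_poly p\<close>[symmetric]
    by (simp only: mult.assoc)
  then obtain K where K: "\<forall>k\<ge>K. fls_nth ((1 - fls_X ^ N) ^ M * L) k = 0"
    using coeff_recurrence_of_poly_multiple by blast
  define b where "b n = fls_nth L (int n - 1)" for n
  have double: "b (2 * n) = b n" for n
    using fixed[of "int n - 1"] by (simp add: b_def algebra_simps)
  have "b (n + N) = b n" if "n > 0" for n
  proof -
    obtain c m k0 where "\<forall>k\<ge>k0. fls_nth L ((int n - 1) + int N * int k) =
        (\<Sum>i<m. c i * of_nat (k choose i))"
      using coeffs_along_progression[OF _ K, of "int n - 1"] N odd_pos by blast
    moreover obtain Q where "\<forall>k. poly Q (of_nat k) = (\<Sum>i<m. c i * of_nat (k choose i))"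
      using binomial_sum_is_poly by blast
    ultimately have "\<forall>k\<ge>k0. b (n + N * k) = poly Q (of_nat k)"
      by (simp add: b_def algebra_simps)
    from doubling_invariant_imp_periodic[OF N that double this] show ?thesis .
  qed
  thus ?thesis using N by (auto simp: b_def L_def)
qed

section \<open>Fourier expansion and the classification\<close>

lemma sum_powers_root_of_unity:
  assumes "primitive_root_of_unity r z" "n < r" "j < r"
  shows "(\<Sum>m<r. z ^ (m * n) / z ^ (m * j)) = (if n = j then of_nat r else 0)"
proof -
  have z: "z \<noteq> 0" "z ^ r = 1" "\<And>k. 0 < k \<Longrightarrow> k < r \<Longrightarrow> z ^ k \<noteq> 1"
    using assms(1) by (auto simp: primitive_root_of_unity_def power_0_left)
  define u where "u = z ^ n / z ^ j"
  have "(\<Sum>m<r. z ^ (m * n) / z ^ (m * j)) = (\<Sum>m<r. u ^ m)"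
    by (simp add: u_def power_divide power_mult mult.commute[of _ n] mult.commute[of _ j])
  also have "\<dots> = (if n = j then of_nat r else 0)"
  proof (cases "n = j")
    case True
    thus ?thesis using z by (simp add: u_def)
  next
    case False
    have neq: "z ^ a \<noteq> z ^ b" if "a < b" "b < r" for a b
    proof
      assume "z ^ a = z ^ b"
      moreover have "z ^ b = z ^ a * z ^ (b - a)" using that by (simp flip: power_add)
      ultimately have "z ^ a * 1 = z ^ a * z ^ (b - a)" by simp
      hence "z ^ (b - a) = 1" using z(1) by simp
      thus False using z(3)[of "b - a"] that by simp
    qed
    have "z ^ n \<noteq> z ^ j"
      using neq[of n j] neq[of j n] False assms(2,3) by (metis linorder_neqE_nat)
    hence "u \<noteq> 1"
      using z(1) by (simp add: u_def)
    moreover have "u ^ r = 1"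
      by (simp add: u_def power_divide z(2) power_commutes power_mult[symmetric]
          mult.commute[of _ r]) (simp add: power_mult z)
    ultimately show ?thesis using False by (simp add: sum_gp_strict)
  qed
  finally show ?thesis .
qed

text \<open>
  Since \<open>2\<close> is invertible modulo \<open>r\<close>, substituting \<open>2 j\<close> for \<open>j\<close> in the sum for
  the Fourier coefficient \<open>c m\<close> turns it into the sum for \<open>c (2 m)\<close>.
\<close>

lemma finite_fourier_doubling:
  fixes b :: "nat \<Rightarrow> complex"
  assumes "odd r" and prim: "primitive_root_of_unity r z"
    and per: "\<And>n. b (n + r) = b n" and double: "\<And>n. b (2 * n) = b n"
  obtains c where "\<And>n. b n = (\<Sum>m<r. c m * z ^ (m * n))"
    and "\<And>s m. c (2 ^ s * m mod r) = c m"
proof -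
  have r: "r > 0" and zr: "z ^ r = 1"
    using prim by (auto simp: primitive_root_of_unity_def)
  define c where "c m = (\<Sum>j<r. b j / z ^ (m * j)) / of_nat r" for m
  have zmod: "z ^ (m * (n mod r)) = z ^ (m * n)" for m n
    using root_of_unity_power_mod[OF zr, of n]
    by (simp add: mult.commute[of m] power_mult)
  have inversion: "b n = (\<Sum>m<r. c m * z ^ (m * n))" for n
  proof -
    have "(\<Sum>m<r. c m * z ^ (m * n)) = (\<Sum>m<r. c m * z ^ (m * (n mod r)))"
      by (simp only: zmod)
    also have "\<dots> = (\<Sum>m<r. \<Sum>j<r. b j / of_nat r * (z ^ (m * (n mod r)) / z ^ (m * j)))"
      by (simp add: c_def sum_distrib_right sum_divide_distrib mult.commute[of "of_nat r"])
    also have "\<dots> = (\<Sum>j<r. b j / of_nat r * (\<Sum>m<r. z ^ (m * (n mod r)) / z ^ (m * j)))"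
      by (subst sum.swap) (simp add: sum_distrib_left)
    also have "\<dots> = (\<Sum>j<r. if n mod r = j then b j else 0)"
      using r by (intro sum.cong) (simp_all add: sum_powers_root_of_unity[OF prim])
    also have "\<dots> = b (n mod r)" using r by simp
    also have "\<dots> = b n" using periodic_mod[of b r, OF per] .
    finally show ?thesis ..
  qed
  have c_double: "c (2 * m) = c m" for m
  proof -
    have "(\<Sum>j<r. b j / z ^ (m * j)) = (\<Sum>j<r. b (2 * j mod r) / z ^ (m * (2 * j mod r)))"
      using bij_betw_double_mod[OF \<open>odd r\<close>, of "{..<r}"] r
      by (intro sum.reindex_bij_betw[symmetric]) auto
    also have "\<dots> = (\<Sum>j<r. b j / z ^ (2 * m * j))"
      by (simp add: zmod periodic_mod[of b r, OF per] double mult.assoc mult.left_commute[of m])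
    finally show ?thesis by (simp add: c_def)
  qed
  have "c (m + r) = c m" for m
    by (simp add: c_def power_add power_mult zr add_mult_distrib)
  hence "c (m mod r) = c m" for m by (rule periodic_mod)
  moreover have "c (2 ^ s * m) = c m" for s m
    by (induction s) (simp_all add: c_double mult.assoc)
  ultimately show ?thesis using that inversion by metis
qed

text \<open>
  The period \<open>r\<close> of the coefficients supplies the functions for a single modulus, and these together
  with \<open>1/x\<close> suffice: the coefficient of \<open>f\<^sub>r\<^sub>,\<^sub>n\<close> is the \<open>n\<close>-th Fourier coefficient, divided
  by the size of its coset because every \<open>f\<^sub>r\<^sub>,\<^sub>n\<close> appears once for each \<open>n\<close> in the coset.
\<close>

lemma frakF_fixed_in_span:
  assumes prim: "\<And>r. odd r \<Longrightarrow> primitive_root_of_unity r (lam r)" and "frakF R = R"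
  shows "R \<in> ratfun.span (insert (Fract 1 [:0, 1:]) {cyc_fun lam r n |r n. odd r \<and> n \<le> r - 1})"
    (is "_ \<in> ratfun.span ?B")
proof -
  obtain r where r: "odd r" and
    per: "\<And>n. n > 0 \<Longrightarrow> fls_nth (laurent R) (int (n + r) - 1) = fls_nth (laurent R) (int n - 1)"
    using fixed_coeffs_periodic[OF assms(2)] by blast
  have fixed: "fls_nth (laurent R) (2 * k + 1) = fls_nth (laurent R) k" for k
    using assms(2) by (simp add: frakF_fixed_iff)
  have "r > 0" using r by (rule odd_pos)
  \<comment> \<open>The shift by one period \<open>r\<close> replaces the irregular coefficient at \<open>n = 0\<close> by the one that
    continues the periodic pattern.\<close>
  define b where "b n = fls_nth (laurent R) (int (n + r) - 1)" for n
  have b_per: "b (n + r) = b n" for n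
    using per[of "n + r"] \<open>r > 0\<close> by (simp add: b_def)
  have b_double: "b (2 * n) = b n" for n
  proof -
    have "b n = fls_nth (laurent R) (int (2 * n + r + r) - 1)"
      using fixed[of "int (n + r) - 1"] by (simp add: b_def algebra_simps)
    also have "\<dots> = b (2 * n)"
      using per[of "2 * n + r"] \<open>r > 0\<close> by (simp only: b_def)
    finally show ?thesis ..
  qed
  obtain c where c: "\<And>n. b n = (\<Sum>m<r. c m * lam r ^ (m * n))"
      "\<And>s m. c (2 ^ s * m mod r) = c m"
    using finite_fourier_doubling[OF r prim[OF r] b_per b_double] by blast
  have c_coset: "c m = c n" if "m \<in> cyc_coset r n" for m n
    using that c(2) by (auto simp: cyc_coset_eq[OF r])
  define S where "S = ratfun_scale (fls_nth (laurent R) (-1)) (Fract 1 [:0, 1:]) +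
    (\<Sum>n<r. ratfun_scale (c n / of_nat (card (cyc_coset r n))) (cyc_fun lam r n))"
  have "fls_nth (laurent R) k = fls_nth (laurent S) k" for k
  proof (cases "k \<ge> 0")
    case False
    thus ?thesis using fixed_coeffs_below_minus_one[of "laurent R" k, OF fixed]
      by (simp add: S_def laurent_add laurent_scale laurent_sum fls_nth_sum
          laurent_inverse_X_nth cyc_fun_nth)
  next
    case True
    define n where "n = nat (k + 1)"
    have "n > 0" "k = int n - 1" using True by (simp_all add: n_def)
    have sum_c: "(\<Sum>n'<r. c n' / of_nat (card (cyc_coset r n')) *
        (\<Sum>m\<in>cyc_coset r n'. lam r ^ (m * n))) = (\<Sum>m<r. c m * lam r ^ (m * n))"
      by (rule sum_over_cyc_cosets[OF r c_coset])
    have "fls_nth (laurent R) k = b n" using \<open>n > 0\<close> \<open>k = int n - 1\<close> per[of n] by (simp add: b_def)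
    also have "\<dots> = fls_nth (laurent S) k"
      using True sum_c
      by (simp add: S_def laurent_add laurent_scale laurent_sum fls_nth_sum
          laurent_inverse_X_nth cyc_fun_nth c(1) n_def)
    finally show ?thesis .
  qed
  hence "R = S" by (simp add: fls_eqI flip: laurent_eq_iff)
  also have "S \<in> ratfun.span ?B"
    unfolding S_def
  proof (intro ratfun.span_add ratfun.span_sum ratfun.span_scale ratfun.span_base)
    fix n assume "n \<in> {..<r}"
    hence "n \<le> r - 1" by auto
    thus "cyc_fun lam r n \<in> ?B" using r by blast
  qed simp
  finally show ?thesis .
qed

theorem theorem4p1:
  fixes lam :: "nat \<Rightarrow> complex" and R :: ratfun
  assumes "\<And>r. odd r \<Longrightarrow> primitive_root_of_unity r (lam r)"
  shows "frakF R = R \<longleftrightarrow>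
    R \<in> ratfun.span (insert (Fract 1 [:0, 1:]) {cyc_fun lam r n |r n. odd r \<and> n \<le> r - 1})"
  using frakF_fixed_in_span[OF assms] frakF_span[of lam R] assms
  by (auto simp: primitive_root_of_unity_def)

end
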